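(* Let $\mathcal{X}$ and $\mathcal{Y}$ be complex Banach spaces, and let $U\in\mathcal{B}(\mathcal{X})$ and $V\in\mathcal{B}(\mathcal{Y})$ be equivalent after extension (EAE). Assume that one of the following two cases holds: (1) $U$ and $V$ are Atkinson and $\mathcal{X}$ and $\mathcal{Y}$ are stable under finite dimensional quotients; (2) $U$ and $V$ are generalized invertible and $\mathcal{X}$ and $\mathcal{Y}$ are primary. Then there exists an operator $W$ on $\mathcal{X}\oplus\mathcal{Y}$ such that $U$ and $W$ are Schur coupled (SC) and $V$ and $W$ are SC. Concretely, each of the two choices $W=U\oplus I_{\mathcal{Y}}$ and $W=I_{\mathcal{X}}\oplus V$ has this property.
   Context: All Banach spaces are complex. $\mathcal{B}(\mathcal{V},\mathcal{W})$ is the space of bounded linear operators from $\mathcal{V}$ to $\mathcal{W}$, and $\mathcal{B}(\mathcal{V})=\mathcal{B}(\mathcal{V},\mathcal{V})$. "Operator" means bounded linear operator; "invertible" means with bounded inverse; $\simeq$ denotes linear homeomorphic isomorphism of Banach spaces. Equivalent after extension (EAE): $U\in\mathcal{B}(\mathcal{X})$ and $V\in\mathcal{B}(\mathcal{Y})$ are EAE if there exist Banach spaces $\mathcal{X}_0,\mathcal{Y}_0$ and invertible operators $E\in\mathcal{B}(\mathcal{Y}\oplus\mathcal{Y}_0,\mathcal{X}\oplus\mathcal{X}_0)$ and $F\in\mathcal{B}(\mathcal{X}\oplus\mathcal{X}_0,\mathcal{Y}\oplus\mathcal{Y}_0)$ with $U\oplus I_{\mathcal{X}_0}=E\,(V\oplus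 I_{\mathcal{Y}_0})\,F$. Schur coupled (SC): $U\in\mathcal{B}(\mathcal{X})$ and $V\in\mathcal{B}(\mathcal{Y})$ are SC if there exists a block operator $\begin{bmatrix}A&B\\C&D\end{bmatrix}\in\mathcal{B}(\mathcal{X}\oplus\mathcal{Y})$ with $A\in\mathcal{B}(\mathcal{X})$ and $D\in\mathcal{B}(\mathcal{Y})$ invertible such that $U=A-BD^{-1}C$ and $V=D-CA^{-1}B$. An operator $T\in\mathcal{B}(\mathcal{V},\mathcal{W})$ is generalized invertible if it has closed complementable range and complementable kernel; equivalently, there are direct sum decompositions $\mathcal{V}=\mathcal{V}_1\oplus\mathcal{V}_2$ and $\mathcal{W}=\mathcal{W}_1\oplus\mathcal{W}_2$ into closed subspaces with respect to which $T=\begin{bmatrix}T'&0\\0&0\end{bmatrix}$ with $T':\mathcal{V}_1\to\mathcal{W}_1$ invertible; then $\mathcal{V}_2=\operatorname{Ker}T$ and $\mathcal{W}_2$ is called the cokernel $\operatorname{Coker}T$. $T$ is Atkinson if it is generalized invertible and at least one of $\operatorname{Ker}T$ and $\operatorname{Coker}T$ is finite dimensional. A Banach space $\mathcal{Z}$ is primary if $\mathcal{Z}\simeq\mathcal{Z}_1\oplus\mathcal{Z}_2$ (with $\mathcal{Z}_1,\mathcal{Z}_2$ Banach spaces) implies $\mathcal{Z}\simeq\mathcal{Z}_1$ or $\mathcal{Z}\simeq\mathcal{Z}_2$. A Banach space $\mathcal{Z}$ is stable under finite dimensional quotients if $\mathcal{Z}$ is isomorphic to each of its (closed) subspaces that has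 a finite dimensional complement. *)

theory Defs
  imports "HOL-Analysis.Analysis"
begin

text \<open>
  Complex Banach spaces extend the real class \<open>banach\<close> by a compatible complex scalar
  multiplication. The direct sum of two spaces is the product type.
\<close>

class complex_banach = banach +
  fixes scaleC :: "complex \<Rightarrow> 'a \<Rightarrow> 'a" (infixr "*\<^sub>C" 75)
  assumes scaleC_add_right: "a *\<^sub>C (x + y) = a *\<^sub>C x + a *\<^sub>C y"
    and scaleC_add_left: "(a + b) *\<^sub>C x = a *\<^sub>C x + b *\<^sub>C x"
    and scaleC_scaleC: "a *\<^sub>C (b *\<^sub>C x) = (a * b) *\<^sub>C x"
    and scaleR_scaleC: "r *\<^sub>R x = complex_of_real r *\<^sub>C x"
    and norm_scaleC: "norm (a *\<^sub>C x) = cmod a * norm x"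

lemma scaleC_one: "1 *\<^sub>C x = x" for x :: "'a::complex_banach"
  using scaleR_scaleC[of 1 x] by simp

global_interpretation complex_vector: vector_space "scaleC :: complex \<Rightarrow> 'a::complex_banach \<Rightarrow> 'a"
  by unfold_locales (simp_all add: scaleC_add_right scaleC_add_left scaleC_scaleC scaleC_one)

instantiation prod :: (complex_banach, complex_banach) complex_banach
begin

definition scaleC_prod :: "complex \<Rightarrow> 'a \<times> 'b \<Rightarrow> 'a \<times> 'b"
  where "scaleC_prod c p = (c *\<^sub>C fst p, c *\<^sub>C snd p)"

instance
proof
  fix a :: complex and x :: "'a \<times> 'b"
  have "sqrt ((cmod a * norm (fst x))\<^sup>2 + (cmod a * norm (snd x))\<^sup>2)
      = sqrt ((cmod a)\<^sup>2 * ((norm (fst x))\<^sup>2 + (norm (snd x))\<^sup>2))"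
    by (simp add: power_mult_distrib distrib_left)
  then show "norm (a *\<^sub>C x) = cmod a * norm x"
    by (simp add: scaleC_prod_def norm_prod_def norm_scaleC real_sqrt_mult)
qed (simp_all add: scaleC_prod_def prod_eq_iff scaleC_add_right scaleC_add_left
      scaleC_scaleC scaleR_scaleC)

end


definition bounded_clinear :: "('a::complex_banach \<Rightarrow> 'b::complex_banach) \<Rightarrow> bool"
  where "bounded_clinear T \<longleftrightarrow> bounded_linear T \<and> (\<forall>c x. T (c *\<^sub>C x) = c *\<^sub>C T x)"

definition invertible_op :: "('a::complex_banach \<Rightarrow> 'b::complex_banach) \<Rightarrow> bool"
  where "invertible_op T \<longleftrightarrow> bounded_clinear T \<and> bij T \<and> bounded_clinear (inv T)"


text \<open>
  The extension spaces are passed as type arguments, since they cannot be existentially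
  quantified inside a formula; as free types in a hypothesis they range over all Banach spaces.
  The operator \<open>U \<oplus> I\<close> is \<open>map_prod U id\<close>.
\<close>

definition equivalent_after_extension ::
  "'x0::complex_banach itself \<Rightarrow> 'y0::complex_banach itself \<Rightarrow>
    ('x::complex_banach \<Rightarrow> 'x) \<Rightarrow> ('y::complex_banach \<Rightarrow> 'y) \<Rightarrow> bool"
  where "equivalent_after_extension _ _ U V \<longleftrightarrow>
    (\<exists>(E :: 'y \<times> 'y0 \<Rightarrow> 'x \<times> 'x0) (F :: 'x \<times> 'x0 \<Rightarrow> 'y \<times> 'y0).
      invertible_op E \<and> invertible_op F \<and>
      map_prod U id = E \<circ> map_prod V id \<circ> F)"

definition schur_coupled ::
  "('x::complex_banach \<Rightarrow> 'x) \<Rightarrow> ('y::complex_banach \<Rightarrow> 'y) \<Rightarrow> bool"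
  where "schur_coupled U V \<longleftrightarrow>
    (\<exists>(A :: 'x \<Rightarrow> 'x) (B :: 'y \<Rightarrow> 'x) (C :: 'x \<Rightarrow> 'y) (D :: 'y \<Rightarrow> 'y).
      bounded_clinear A \<and> bounded_clinear B \<and> bounded_clinear C \<and> bounded_clinear D \<and>
      invertible_op A \<and> invertible_op D \<and>
      U = (\<lambda>x. A x - B (inv D (C x))) \<and>
      V = (\<lambda>y. D y - C (inv A (B y))))"


definition closed_csubspace :: "'a::complex_banach set \<Rightarrow> bool"
  where "closed_csubspace S \<longleftrightarrow> complex_vector.subspace S \<and> closed S"

definition closed_direct_sum :: "'a::complex_banach set \<Rightarrow> 'a set \<Rightarrow> bool"
  where "closed_direct_sum S T \<longleftrightarrow>
    closed_csubspace S \<and> closed_csubspace T \<and> S \<inter> T = {0} \<and> (\<forall>x. \<exists>s\<in>S. \<exists>t\<in>T. x = s + t)"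

definition complementable :: "'a::complex_banach set \<Rightarrow> bool"
  where "complementable S \<longleftrightarrow> (\<exists>T. closed_direct_sum S T)"

definition cfinite_dim :: "'a::complex_banach set \<Rightarrow> bool"
  where "cfinite_dim S \<longleftrightarrow> (\<exists>B. finite B \<and> S = complex_vector.span B)"

definition generalized_invertible :: "('a::complex_banach \<Rightarrow> 'b::complex_banach) \<Rightarrow> bool"
  where "generalized_invertible T \<longleftrightarrow>
    bounded_clinear T \<and> closed (range T) \<and> complementable (range T) \<and> complementable {x. T x = 0}"

text \<open>
  The cokernel is a closed complement of the range; its dimension does not depend on the choice.
\<close>

definition atkinson :: "('a::complex_banach \<Rightarrow> 'b::complex_banach) \<Rightarrow> bool"
  where "atkinson T \<longleftrightarrow> generalized_invertible T \<and>
    (cfinite_dim {x. T x = 0} \<or> (\<exists>W. closed_direct_sum (range T) W \<and> cfinite_dim W))"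


text \<open>
  Isomorphism of the Banach spaces carried by closed subspaces; a whole space is \<open>UNIV\<close>.
\<close>

definition linearly_homeomorphic ::
  "'a::complex_banach set \<Rightarrow> 'b::complex_banach set \<Rightarrow> bool" (infix "\<simeq>\<^sub>B" 50)
  where "S \<simeq>\<^sub>B T \<longleftrightarrow> (\<exists>f g. homeomorphism S T f g \<and>
    (\<forall>x\<in>S. \<forall>y\<in>S. f (x + y) = f x + f y) \<and> (\<forall>c. \<forall>x\<in>S. f (c *\<^sub>C x) = c *\<^sub>C f x))"

text \<open>
  In the definition of primary spaces, the summands range over the Banach spaces carried by
  closed subspaces of the space itself. Every summand, of whatever type, is isomorphic to such a
  subspace, so this is no restriction: see \<open>primary_summands\<close> below.
\<close>

definition primary :: "'z::complex_banach itself \<Rightarrow> bool"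
  where "primary _ \<longleftrightarrow> (\<forall>(Z1 :: 'z set) (Z2 :: 'z set).
    closed_csubspace Z1 \<and> closed_csubspace Z2 \<and> (UNIV :: 'z set) \<simeq>\<^sub>B Z1 \<times> Z2 \<longrightarrow>
    (UNIV :: 'z set) \<simeq>\<^sub>B Z1 \<or> (UNIV :: 'z set) \<simeq>\<^sub>B Z2)"

definition stable_under_fd_quotients :: "'z::complex_banach itself \<Rightarrow> bool"
  where "stable_under_fd_quotients _ \<longleftrightarrow> (\<forall>(S :: 'z set) (F :: 'z set).
    closed_direct_sum S F \<and> cfinite_dim F \<longrightarrow> (UNIV :: 'z set) \<simeq>\<^sub>B S)"

lemma linearly_homeomorphic_trans:
  assumes "S \<simeq>\<^sub>B T" "T \<simeq>\<^sub>B R"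
  shows "S \<simeq>\<^sub>B R"
proof -
  obtain f g where f: "homeomorphism S T f g" "\<forall>x\<in>S. \<forall>y\<in>S. f (x + y) = f x + f y"
      "\<forall>c. \<forall>x\<in>S. f (c *\<^sub>C x) = c *\<^sub>C f x"
    using assms(1) unfolding linearly_homeomorphic_def by blast
  obtain h k where h: "homeomorphism T R h k" "\<forall>x\<in>T. \<forall>y\<in>T. h (x + y) = h x + h y"
      "\<forall>c. \<forall>x\<in>T. h (c *\<^sub>C x) = c *\<^sub>C h x"
    using assms(2) unfolding linearly_homeomorphic_def by blast
  have "\<And>x. x \<in> S \<Longrightarrow> f x \<in> T"
    using f(1) by (auto simp: homeomorphism_def)
  then have "\<forall>x\<in>S. \<forall>y\<in>S. (h \<circ> f) (x + y) = (h \<circ> f) x + (h \<circ> f) y"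
      "\<forall>c. \<forall>x\<in>S. (h \<circ> f) (c *\<^sub>C x) = c *\<^sub>C (h \<circ> f) x"
    using f h by simp_all
  then show ?thesis
    unfolding linearly_homeomorphic_def using homeomorphism_compose[OF f(1) h(1)] by blast
qed

lemma primary_summands:
  fixes S :: "'a::complex_banach set" and T :: "'b::complex_banach set"
  assumes P: "primary TYPE('z::complex_banach)"
    and S: "closed_csubspace S" and T: "closed_csubspace T"
    and iso: "(UNIV :: 'z set) \<simeq>\<^sub>B S \<times> T"
  shows "(UNIV :: 'z set) \<simeq>\<^sub>B S \<or> (UNIV :: 'z set) \<simeq>\<^sub>B T"
proof -
  obtain f :: "'z \<Rightarrow> 'a \<times> 'b" and g where h: "homeomorphism UNIV (S \<times> T) f g"
    and add: "\<And>x y. f (x + y) = f x + f y" and sc: "\<And>c x. f (c *\<^sub>C x) = c *\<^sub>C f x"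
    using iso unfolding linearly_homeomorphic_def by blast
  have gf: "\<And>z. g (f z) = z" and fg: "\<And>a b. a \<in> S \<Longrightarrow> b \<in> T \<Longrightarrow> f (g (a, b)) = (a, b)"
    and fin: "\<And>z. fst (f z) \<in> S" "\<And>z. snd (f z) \<in> T"
    and cf: "continuous_on UNIV f" and cg: "continuous_on (S \<times> T) g"
    using h by (auto simp: homeomorphism_def mem_Times_iff image_subset_iff set_eq_subset)
  have f0: "f 0 = 0"
    using add[of 0 0] by simp
  have S0: "0 \<in> S" and T0: "0 \<in> T"
    using S T by (auto simp: closed_csubspace_def complex_vector.subspace_def)
  have cl: "\<And>x y. x \<in> S \<Longrightarrow> y \<in> S \<Longrightarrow> x + y \<in> S" "\<And>c x. x \<in> S \<Longrightarrow> c *\<^sub>C x \<in> S"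
    "\<And>x y. x \<in> T \<Longrightarrow> y \<in> T \<Longrightarrow> x + y \<in> T" "\<And>c x. x \<in> T \<Longrightarrow> c *\<^sub>C x \<in> T"
    using S T by (auto simp: closed_csubspace_def complex_vector.subspace_def)
  define Z1 where "Z1 = {z. snd (f z) = 0}"
  define Z2 where "Z2 = {z. fst (f z) = 0}"
  have cs: "closed_csubspace Z1" "closed_csubspace Z2"
    unfolding closed_csubspace_def complex_vector.subspace_def Z1_def Z2_def
    by (auto simp: f0 add sc scaleC_prod_def
        intro!: closed_Collect_eq continuous_intros cf)
  have cg1: "continuous_on A (\<lambda>x. g (p x, 0))" if "continuous_on A p" "p ` A \<subseteq> S"
    for A :: "'c::topological_space set" and p
    by (rule continuous_on_compose2[OF cg]) (use that T0 in \<open>auto intro!: continuous_intros\<close>)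
  have cg2: "continuous_on A (\<lambda>x. g (0, p x))" if "continuous_on A p" "p ` A \<subseteq> T"
    for A :: "'c::topological_space set" and p
    by (rule continuous_on_compose2[OF cg]) (use that S0 in \<open>auto intro!: continuous_intros\<close>)
  have inj: "\<And>x y. f x = f y \<Longrightarrow> x = y"
    using gf by metis
  have cfst: "continuous_on A (\<lambda>z. fst (f z))" and csnd: "continuous_on A (\<lambda>z. snd (f z))" for A
    by (auto intro!: continuous_intros continuous_on_subset[OF cf])
  have i1: "Z1 \<simeq>\<^sub>B S"
    unfolding linearly_homeomorphic_def
  proof (intro exI conjI)
    show "homeomorphism Z1 S (\<lambda>z. fst (f z)) (\<lambda>a. g (a, 0))"
    proof (rule homeomorphismI)
      show "continuous_on S (\<lambda>a. g (a, 0))"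
        by (rule cg1) auto
      show "\<And>x. x \<in> Z1 \<Longrightarrow> g (fst (f x), 0) = x"
        by (metis (mono_tags) Z1_def gf mem_Collect_eq prod.collapse)
    qed (use fin fg T0 cfst in \<open>auto simp: Z1_def\<close>)
  qed (auto simp: add sc scaleC_prod_def)
  have i2: "Z2 \<simeq>\<^sub>B T"
    unfolding linearly_homeomorphic_def
  proof (intro exI conjI)
    show "homeomorphism Z2 T (\<lambda>z. snd (f z)) (\<lambda>a. g (0, a))"
    proof (rule homeomorphismI)
      show "continuous_on T (\<lambda>a. g (0, a))"
        by (rule cg2) auto
      show "\<And>x. x \<in> Z2 \<Longrightarrow> g (0, snd (f x)) = x"
        by (metis (mono_tags) Z2_def gf mem_Collect_eq prod.collapse)
    qed (use fin fg S0 csnd in \<open>auto simp: Z2_def\<close>)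
  qed (auto simp: add sc scaleC_prod_def)
  have "(UNIV :: 'z set) \<simeq>\<^sub>B Z1 \<times> Z2"
    unfolding linearly_homeomorphic_def
  proof (intro exI conjI)
    show "homeomorphism UNIV (Z1 \<times> Z2) (\<lambda>z. (g (fst (f z), 0), g (0, snd (f z)))) (\<lambda>p. fst p + snd p)"
    proof (rule homeomorphismI)
      show "continuous_on UNIV (\<lambda>z. (g (fst (f z), 0), g (0, snd (f z))))"
        by (intro continuous_on_Pair cg1 cg2 cfst csnd) (use fin in auto)
      show "fst (g (fst (f x), 0), g (0, snd (f x))) + snd (g (fst (f x), 0), g (0, snd (f x))) = x"
        for x
        by (rule inj) (simp add: add fg fin S0 T0)
      show "(g (fst (f (fst y + snd y)), 0), g (0, snd (f (fst y + snd y)))) = y"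
        if "y \<in> Z1 \<times> Z2" for y
        using that by (auto simp: Z1_def Z2_def add prod_eq_iff fg fin S0 T0 intro!: inj)
    qed (auto intro!: continuous_intros simp: Z1_def Z2_def fg fin S0 T0)
  qed (auto simp: add sc fg fin S0 T0 cl scaleC_prod_def intro!: inj)
  then have "(UNIV :: 'z set) \<simeq>\<^sub>B Z1 \<or> (UNIV :: 'z set) \<simeq>\<^sub>B Z2"
    using P cs unfolding primary_def by blast
  then show ?thesis
    using linearly_homeomorphic_trans[OF _ i1] linearly_homeomorphic_trans[OF _ i2] by blast
qed

end

theory Submission
  imports Defs
begin

text \<open>
  \<open>U\<close> and \<open>U \<oplus> I\<close> are always Schur coupled, and Schur coupling is preserved when one of the
  two operators is replaced by an equivalent one. So it is enough that \<open>U \<oplus> I\<close> and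
  \<open>I \<oplus> V\<close> are equivalent. Equivalence after extension makes the kernels of \<open>U\<close> and \<open>V\<close>
  isomorphic, and likewise their cokernels. If \<open>U\<close> and \<open>V\<close> are generalized invertible, with
  \<open>X = X1 \<oplus> Ker U\<close> and \<open>Y = Y1 \<oplus> Ker V\<close>, then also
  \<open>X1 \<oplus> Y \<simeq> X1 \<oplus> Ker V \<oplus> Y1 \<simeq> X1 \<oplus> Ker U \<oplus> Y1 \<simeq> X \<oplus> Y1\<close>, so the ranges of
  \<open>U \<oplus> I\<close> and \<open>I \<oplus> V\<close> are isomorphic as well.
\<close>

subsection \<open>Bounded complex linear maps\<close>

lemma bounded_clinear_compose:
  assumes "bounded_clinear f" "bounded_clinear g"
  shows "bounded_clinear (\<lambda>x. f (g x))"
  using assms by (auto simp: bounded_clinear_def intro: bounded_linear_compose)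

lemma bounded_clinear_ident: "bounded_clinear (\<lambda>x. x)"
  by (simp add: bounded_clinear_def bounded_linear_ident)

lemma bounded_clinear_zero: "bounded_clinear (\<lambda>x. 0)"
  by (simp add: bounded_clinear_def)

lemma bounded_clinear_add:
  assumes "bounded_clinear f" "bounded_clinear g"
  shows "bounded_clinear (\<lambda>x. f x + g x)"
  using assms by (auto simp: bounded_clinear_def scaleC_add_right intro: bounded_linear_add)

lemma bounded_clinear_diff:
  assumes "bounded_clinear f" "bounded_clinear g"
  shows "bounded_clinear (\<lambda>x. f x - g x)"
  using assms
  by (auto simp: bounded_clinear_def complex_vector.scale_right_diff_distrib intro: bounded_linear_sub)

lemma bounded_clinear_Pair:
  assumes "bounded_clinear f" "bounded_clinear g"
  shows "bounded_clinear (\<lambda>x. (f x, g x))"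
  using assms by (auto simp: bounded_clinear_def scaleC_prod_def intro: bounded_linear_Pair)

lemma bounded_clinear_fst: "bounded_clinear fst" and bounded_clinear_snd: "bounded_clinear snd"
  by (auto simp: bounded_clinear_def scaleC_prod_def bounded_linear_fst bounded_linear_snd)

lemmas bounded_clinear_intros =
  bounded_clinear_ident bounded_clinear_zero bounded_clinear_add bounded_clinear_diff
  bounded_clinear_Pair
  bounded_clinear_compose[OF bounded_clinear_fst] bounded_clinear_compose[OF bounded_clinear_snd]

lemma
  assumes "bounded_clinear f"
  shows bounded_clinear_map_add: "f (x + y) = f x + f y"
    and bounded_clinear_map_diff: "f (x - y) = f x - f y"
    and bounded_clinear_map_0: "f 0 = 0"
  using assms by (auto simp: bounded_clinear_def linear_simps)

lemma bounded_clinear_map_prod: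
  assumes "bounded_clinear f" "bounded_clinear g"
  shows "bounded_clinear (map_prod f g)"
proof -
  have "map_prod f g = (\<lambda>p. (f (fst p), g (snd p)))"
    by auto
  moreover have "bounded_clinear (\<lambda>p. (f (fst p), g (snd p)))"
    by (intro bounded_clinear_intros bounded_clinear_compose[OF assms(1)]
        bounded_clinear_compose[OF assms(2)])
  ultimately show ?thesis
    by simp
qed

lemma invertible_opI:
  assumes "bounded_clinear f" "bounded_clinear g" "\<And>x. g (f x) = x" "\<And>y. f (g y) = y"
  shows "invertible_op f"
proof -
  have "inv f = g"
    using assms(3,4) by (intro inv_unique_comp) auto
  moreover have "bij f"
    using assms(3,4) by (intro o_bij[of g]) auto
  ultimately show ?thesis
    using assms by (simp add: invertible_op_def)
qed

lemma invertible_op_inv_simps: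
  assumes "invertible_op f"
  shows "inv f (f x) = x" "f (inv f y) = y"
  using assms by (auto simp: invertible_op_def bij_def surj_f_inv_f)

lemma invertible_op_inv:
  assumes "invertible_op f"
  shows "invertible_op (inv f)"
  using assms by (auto simp: invertible_op_def bij_imp_bij_inv inv_inv_eq)

lemma invertible_op_compose:
  assumes "invertible_op f" "invertible_op g"
  shows "invertible_op (f \<circ> g)" "inv (f \<circ> g) = inv g \<circ> inv f"
proof -
  show inv: "inv (f \<circ> g) = inv g \<circ> inv f"
    using assms by (simp add: invertible_op_def o_inv_distrib)
  have "bounded_clinear (f \<circ> g)" "bounded_clinear (inv g \<circ> inv f)"
    using assms by (simp_all add: invertible_op_def comp_def bounded_clinear_compose)
  then show "invertible_op (f \<circ> g)"
    using assms unfolding invertible_op_def inv by (blast intro: bij_comp)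
qed

lemma invertible_op_id: "invertible_op (\<lambda>x. x)"
  by (rule invertible_opI[where g = "\<lambda>x. x"]) (auto intro: bounded_clinear_ident)

lemma invertible_op_swap: "invertible_op prod.swap"
proof (rule invertible_opI[where g = prod.swap])
  show "bounded_clinear (prod.swap :: 'a::complex_banach \<times> 'b::complex_banach \<Rightarrow> 'b \<times> 'a)"
      "bounded_clinear (prod.swap :: 'b \<times> 'a \<Rightarrow> 'a \<times> 'b)"
    unfolding prod.swap_def by (intro bounded_clinear_intros)+
qed auto

subsection \<open>Schur coupling and equivalence\<close>

text \<open>The coupling \<open>A, B, C, D\<close> becomes \<open>A, B F, E C, E D F\<close>. In the
  Schur complement giving \<open>U\<close>, the factors \<open>E\<close> and \<open>F\<close> cancel
  against those of the inverse of \<open>E D F\<close>; the other complement picks up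
  \<open>E\<close> on the left and \<open>F\<close> on the right.\<close>

lemma schur_coupled_equivalent:
  assumes sc: "schur_coupled U V" and E: "invertible_op E" and F: "invertible_op F"
  shows "schur_coupled U (E \<circ> V \<circ> F)"
proof -
  obtain A B C D where b: "bounded_clinear A" "bounded_clinear B" "bounded_clinear C"
      and i: "invertible_op A" "invertible_op D"
      and U: "U = (\<lambda>x. A x - B (inv D (C x)))" and V: "V = (\<lambda>y. D y - C (inv A (B y)))"
    using sc unfolding schur_coupled_def by blast
  have bE: "bounded_clinear E" and bF: "bounded_clinear F"
    using E F by (auto simp: invertible_op_def)
  have EDF: "invertible_op (E \<circ> D \<circ> F)" "inv (E \<circ> D \<circ> F) = inv F \<circ> (inv D \<circ> inv E)"
    using invertible_op_compose E F i by metis+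
  show ?thesis
    unfolding schur_coupled_def
  proof (intro exI conjI)
    show "bounded_clinear (B \<circ> F)" "bounded_clinear (E \<circ> C)"
      using b bE bF by (auto simp: comp_def bounded_clinear_compose)
    show "bounded_clinear (E \<circ> D \<circ> F)"
      using EDF(1) by (simp add: invertible_op_def)
    show "U = (\<lambda>x. A x - (B \<circ> F) (inv (E \<circ> D \<circ> F) ((E \<circ> C) x)))"
      by (simp add: EDF(2) U invertible_op_inv_simps[OF E] invertible_op_inv_simps[OF F])
    show "E \<circ> V \<circ> F = (\<lambda>y. (E \<circ> D \<circ> F) y - (E \<circ> C) (inv A ((B \<circ> F) y)))"
      by (simp add: V bounded_clinear_map_diff[OF bE] fun_eq_iff)
  qed (use b i EDF in auto)
qed

text \<open>Both diagonal blocks are identities, \<open>?C\<close> embeds the first summand and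
  \<open>?B\<close> is \<open>I - U\<close> on it. One complement is \<open>I - (I - U)\<close>, the
  other subtracts \<open>I - U\<close> in the first coordinate only.\<close>

lemma schur_coupled_map_prod_id_right:
  assumes U: "bounded_clinear U"
  shows "schur_coupled U (map_prod U (id :: 'y::complex_banach \<Rightarrow> 'y))"
  unfolding schur_coupled_def
proof (intro exI conjI)
  have [simp]: "inv (\<lambda>x. x) = (\<lambda>x. x)"
    using inv_id by (simp add: id_def)
  let ?B = "\<lambda>p :: 'a \<times> 'y. fst p - U (fst p)" and ?C = "\<lambda>x. (x, 0 :: 'y)"
  show "bounded_clinear ?B" "bounded_clinear ?C"
    by (intro bounded_clinear_intros bounded_clinear_compose[OF U])+
  show "U = (\<lambda>x. x - ?B (inv (\<lambda>x. x) (?C x)))"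
    by simp
  show "map_prod U id = (\<lambda>y. y - ?C (inv (\<lambda>x. x) (?B y)))"
    by (auto simp: fun_eq_iff prod_eq_iff)
qed (auto intro: bounded_clinear_ident invertible_op_id)

lemma schur_coupled_map_prod_id_left:
  assumes "bounded_clinear V"
  shows "schur_coupled V (map_prod (id :: 'x::complex_banach \<Rightarrow> 'x) V)"
proof -
  have "map_prod (id :: 'x \<Rightarrow> 'x) V = prod.swap \<circ> map_prod V id \<circ> prod.swap"
    by auto
  moreover have "schur_coupled V (prod.swap \<circ> map_prod V (id :: 'x \<Rightarrow> 'x) \<circ> prod.swap)"
    by (intro schur_coupled_equivalent schur_coupled_map_prod_id_right invertible_op_swap assms)
  ultimately show ?thesis
    by simp
qed

subsection \<open>Generalized inverses\<close>

text \<open>A quantitative open mapping theorem for a subspace given as a set. By Baire, the closure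
  of the image of some ball in \<open>S\<close> has interior, which yields preimages up to an error
  of half the norm; summing successive corrections makes them exact.\<close>

lemma open_mapping_closed_subspace:
  fixes f :: "'a::banach \<Rightarrow> 'b::banach"
  assumes f: "bounded_linear f" and S: "subspace S" "closed S" and surj: "f ` S = UNIV"
  obtains M where "\<And>y. \<exists>x\<in>S. f x = y \<and> norm x \<le> M * norm y"
proof -
  interpret f: bounded_linear f by (rule f)
  define C where "C n = closure (f ` (S \<inter> cball 0 (real n)))" for n :: nat
  have "\<exists>n. interior (C n) \<noteq> {}"
  proof (rule ccontr)
    assume "\<not> ?thesis"
    then have "closed (C n)" "interior (C n) = {}" for n
      unfolding C_def by (blast intro: closed_closure)+
    then have "euclidean interior_of \<Union>(range C) = {}"
      by (intro Baire_category_alt disjI1 completely_metrizable_space_euclidean) auto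
    moreover have "\<Union>(range C) = UNIV"
    proof -
      have "y \<in> \<Union>(range C)" for y
      proof -
        obtain x where x: "x \<in> S" "y = f x"
          using surj by blast
        obtain n where "norm x \<le> real n"
          using real_arch_simple by blast
        then have "y \<in> C n"
          unfolding C_def using x by (intro closure_subset[THEN subsetD]) auto
        then show ?thesis by blast
      qed
      then show ?thesis by blast
    qed
    ultimately show False
      by simp
  qed
  then obtain n y0 where "y0 \<in> interior (C n)"
    by blast
  then obtain r where r: "r > 0" "cball y0 r \<subseteq> C n"
    by (meson mem_interior_cball)
  \<comment> \<open>Two points of the ball of radius \<open>n\<close> differ by at most
    \<open>2 n\<close>, and rescaling from length \<open>r\<close> to length \<open>norm y\<close>
    multiplies by \<open>norm y / r\<close>.\<close>
  define K where "K = 2 * real n / r"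
  have approx: "\<exists>x\<in>S. norm x \<le> K * norm y \<and> norm (y - f x) \<le> norm y / 2" for y
  proof (cases "y = 0")
    case True
    then show ?thesis
      using S by (intro bexI[of _ 0]) (auto simp: subspace_0 f.zero)
  next
    case False
    \<comment> \<open>This stretches \<open>y\<close> to length \<open>r\<close>, so that the
      translate of \<open>y0\<close> stays in \<open>cball y0 r\<close>. Two errors of
      \<open>t * norm y / 4\<close> leave at most \<open>norm y / 2\<close> after division by
      \<open>t\<close>.\<close>
    define t where "t = r / norm y"
    have t: "t > 0"
      using r False by (simp add: t_def)
    have "y0 \<in> C n" "y0 + t *\<^sub>R y \<in> C n"
      using r False by (auto intro!: r(2)[THEN subsetD] simp: dist_norm t_def)
    moreover have "t * norm y / 4 > 0"
      using t False by simp
    ultimately have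
      "\<exists>z\<in>f ` (S \<inter> cball 0 (real n)). norm (z - (y0 + t *\<^sub>R y)) < t * norm y / 4"
      "\<exists>z\<in>f ` (S \<inter> cball 0 (real n)). norm (z - y0) < t * norm y / 4"
      unfolding C_def closure_approachable dist_norm by blast+
    then obtain x1 x2 where x: "x1 \<in> S" "norm x1 \<le> n" "x2 \<in> S" "norm x2 \<le> n"
        "norm (f x1 - (y0 + t *\<^sub>R y)) < t * norm y / 4" "norm (f x2 - y0) < t * norm y / 4"
      by auto
    let ?x = "(x1 - x2) /\<^sub>R t"
    have "norm (x1 - x2) \<le> 2 * real n"
      using norm_triangle_ineq4[of x1 x2] x by simp
    then have "norm ?x \<le> 2 * real n / t"
      using t by (simp add: divide_inverse mult.commute)
    then have 1: "norm ?x \<le> K * norm y"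
      by (simp add: K_def t_def)
    define z where "z = (f x2 - y0) - (f x1 - (y0 + t *\<^sub>R y))"
    have "norm z \<le> t * (norm y / 2)"
      using norm_triangle_ineq4[of "f x2 - y0" "f x1 - (y0 + t *\<^sub>R y)"] x(5,6)
      unfolding z_def by linarith
    moreover have "t *\<^sub>R (y - f ?x) = z"
      using t by (simp add: z_def f.scaleR f.diff scaleR_diff_right)
    then have "norm z = t * norm (y - f ?x)"
      using t by (metis norm_scaleR abs_of_pos)
    ultimately have "norm (y - f ?x) \<le> norm y / 2"
      using t by (metis mult_le_cancel_left_pos)
    then show ?thesis
      using 1 x S by (intro bexI[of _ ?x]) (auto simp: subspace_diff subspace_scale)
  qed
  then obtain g where g: "\<And>y. g y \<in> S" "\<And>y. norm (g y) \<le> K * norm y"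
      "\<And>y. norm (y - f (g y)) \<le> norm y / 2"
    by metis
  have K: "K \<ge> 0"
    using r by (simp add: K_def)
  have "\<exists>x\<in>S. f x = y \<and> norm x \<le> 2 * K * norm y" for y
  proof -
    \<comment> \<open>The part of \<open>y\<close> still missing after \<open>n\<close> corrections.
      Its norm at least halves each time, whence the geometric bound and the factor 2 in
      \<open>2 * K\<close>.\<close>
    define res where "res n = ((\<lambda>z. z - f (g z)) ^^ n) y" for n
    have res_Suc: "res (Suc n) = res n - f (g (res n))" for n
      by (simp add: res_def)
    have res_le: "norm (res n) \<le> norm y * (1/2) ^ n" for n
    proof (induction n)
      case (Suc n)
      then show ?case
        using g(3)[of "res n"] by (simp add: res_Suc)
    qed (simp add: res_def)
    have le: "norm (g (res n)) \<le> K * norm y * (1/2) ^ n" for n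
      using order_trans[OF g(2)[of "res n"] mult_left_mono[OF res_le[of n] K]]
      by (simp add: mult.assoc)
    have geo: "(\<lambda>n. K * norm y * (1/2) ^ n) sums (K * norm y * 2)"
      using sums_mult[OF geometric_sums[of "1/2 :: real"]] by simp
    have summ: "summable (\<lambda>n. g (res n))"
      using sums_summable[OF geo] le by (rule summable_comparison_test')
    define x where "x = (\<Sum>n. g (res n))"
    have sums: "(\<lambda>n. g (res n)) sums x"
      using summ by (simp add: x_def summable_sums)
    have "x \<in> S"
    proof (rule closed_sequentially[OF S(2)])
      show "(\<lambda>n. \<Sum>i<n. g (res i)) \<longlonglongrightarrow> x"
        using sums by (simp add: sums_def)
    qed (intro subspace_sum S g)
    moreover have "f x = y"
    proof -
      have "res \<longlonglongrightarrow> 0"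
      proof (rule Lim_null_comparison)
        show "(\<lambda>n. norm y * (1/2) ^ n) \<longlonglongrightarrow> 0"
          by (rule tendsto_mult_right_zero) (simp add: LIMSEQ_realpow_zero)
      qed (use res_le in auto)
      from telescope_sums'[OF this] have "(\<lambda>n. f (g (res n))) sums res 0"
        by (simp add: res_Suc)
      then have "(\<lambda>n. f (g (res n))) sums y"
        by (simp add: res_def)
      then show ?thesis
        using f.sums[OF sums] sums_unique2 by blast
    qed
    moreover have "norm x \<le> 2 * K * norm y"
      using norm_suminf_le[OF le sums_summable[OF geo]] sums_unique[OF geo]
      by (simp add: x_def mult_ac)
    ultimately show ?thesis by blast
  qed
  then show thesis
    using that by blast
qed

text \<open>\<open>G\<close> inverts \<open>T\<close> between a complement of the kernel and the
  range, and vanishes on a complement of the range. Then \<open>I - G T\<close> projects onto the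
  kernel and \<open>I - T G\<close> onto a complement of the range, so that equations between
  operators can replace subspaces.\<close>

lemma generalized_inverse_exists:
  fixes T :: "'a::complex_banach \<Rightarrow> 'b::complex_banach"
  assumes "generalized_invertible T"
  obtains G where "bounded_clinear G" "\<And>x. T (G (T x)) = T x" "\<And>y. G (T (G y)) = G y"
proof -
  obtain N W where T: "bounded_clinear T"
      and N: "closed_direct_sum {x. T x = 0} N" and W: "closed_direct_sum (range T) W"
    using assms unfolding generalized_invertible_def complementable_def by blast
  have subN: "complex_vector.subspace N" and subW: "complex_vector.subspace W"
      and clN: "closed N" and clW: "closed W"
    using N W by (auto simp: closed_direct_sum_def closed_csubspace_def)
  define f where "f p = T (fst p) + snd p" for p
  have f: "bounded_clinear f"
    unfolding f_def by (intro bounded_clinear_intros bounded_clinear_compose[OF T])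
  note T_simps = bounded_clinear_map_0[OF T] bounded_clinear_map_add[OF T]
    bounded_clinear_map_diff[OF T]
  \<comment> \<open>Dropping the kernel component of \<open>x\<close> does not change
    \<open>T x\<close>.\<close>
  have decN: "\<exists>k\<in>N. T k = T x" for x
  proof -
    obtain s t where "T s = 0" "t \<in> N" "x = s + t"
      using N unfolding closed_direct_sum_def by blast
    then show ?thesis
      using T_simps by auto
  qed
  have inj: "p = q" if "p \<in> N \<times> W" "q \<in> N \<times> W" "f p = f q" for p q
  proof -
    have "T (fst p - fst q) = snd q - snd p"
      unfolding bounded_clinear_map_diff[OF T] using that(3) by (simp add: f_def algebra_simps)
    moreover have "snd q - snd p \<in> W" "fst p - fst q \<in> N"
      using that subN subW by (auto intro: complex_vector.subspace_diff)
    moreover have "range T \<inter> W = {0}" "{x. T x = 0} \<inter> N = {0}"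
      using N W by (auto simp: closed_direct_sum_def)
    ultimately have "snd q - snd p = 0" "fst p - fst q = 0"
      by (metis IntI rangeI singletonD, smt (verit) IntI mem_Collect_eq rangeI singletonD)
    then show ?thesis
      by (simp add: prod_eq_iff)
  qed
  have sub: "complex_vector.subspace (N \<times> W)"
    using subN subW unfolding complex_vector.subspace_def
    by (auto simp: scaleC_prod_def zero_prod_def)
  have "subspace (N \<times> W)"
    using sub unfolding complex_vector.subspace_def subspace_def scaleR_scaleC by blast
  moreover have "closed (N \<times> W)"
    by (intro closed_Times clN clW)
  moreover have "f ` (N \<times> W) = UNIV"
  proof -
    have "y \<in> f ` (N \<times> W)" for y
    proof -
      obtain x w where "w \<in> W" "y = T x + w"
        using W unfolding closed_direct_sum_def by blast
      moreover obtain k where "k \<in> N" "T k = T x"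
        using decN by blast
      ultimately show ?thesis
        by (intro image_eqI[of _ _ "(k, w)"]) (auto simp: f_def)
    qed
    then show ?thesis by blast
  qed
  txt \<open>
    The inverse of \<open>f\<close> sends \<open>y\<close> to its preimage in \<open>N\<close> and its component in \<open>W\<close>, so one
    application of the open mapping theorem bounds the inverse of \<open>T\<close> on its range and the
    projection onto the range.
  \<close>
  ultimately obtain M where "\<And>y. \<exists>p\<in>N \<times> W. f p = y \<and> norm p \<le> M * norm y"
    using open_mapping_closed_subspace[of f "N \<times> W"] f unfolding bounded_clinear_def by metis
  then obtain h where h: "\<And>y. h y \<in> N \<times> W" "\<And>y. f (h y) = y" "\<And>y. norm (h y) \<le> M * norm y"
    by metis
  \<comment> \<open>Preimages in \<open>N \<times> W\<close> are unique, so linearity of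
    \<open>h\<close> can be checked after applying \<open>f\<close>.\<close>
  have h_eq: "h y = p" if "p \<in> N \<times> W" "f p = y" for p y
    using inj h that by metis
  have fC: "f (c *\<^sub>C p) = c *\<^sub>C f p" for c p
    using f unfolding bounded_clinear_def by blast
  have h_add: "h (x + y) = h x + h y" for x y
    using h by (intro h_eq complex_vector.subspace_add[OF sub])
      (auto simp: bounded_clinear_map_add[OF f])
  have h_scale: "h (c *\<^sub>C x) = c *\<^sub>C h x" for c x
    using h by (intro h_eq complex_vector.subspace_scale[OF sub]) (auto simp: fC)
  have "bounded_linear h"
    using h(3) by (intro bounded_linear_intro[where K = M])
      (auto simp: h_add h_scale scaleR_scaleC mult.commute)
  then have "bounded_clinear h"
    by (simp add: bounded_clinear_def h_scale)
  then have "bounded_clinear (\<lambda>y. fst (h y))"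
    by (intro bounded_clinear_intros)
  moreover have hT: "h (T k) = (k, 0)" if "k \<in> N" for k
    using that complex_vector.subspace_0[OF subW] by (intro h_eq) (auto simp: f_def)
  have "T (fst (h (T x))) = T x" for x
    using decN[of x] hT by force
  moreover have "fst (h (T (fst (h y)))) = fst (h y)" for y
    using hT[of "fst (h y)"] h(1)[of y] by (simp add: mem_Times_iff)
  ultimately show thesis
    using that by blast
qed

subsection \<open>From equivalence after extension to equivalence\<close>

text \<open>Since \<open>E\<close> is injective, \<open>F\<close> carries the kernel of
  \<open>U \<oplus> I\<close> into that of \<open>V \<oplus> I\<close>, and both kernels lie in the
  first summand.\<close>

lemma kernel_transfer:
  assumes eq: "map_prod U id = E \<circ> map_prod V id \<circ> F" and E: "invertible_op E" and k: "U k = 0"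
  shows "F (k, 0) = (fst (F (k, 0)), 0)" "V (fst (F (k, 0))) = 0"
proof -
  have "E (map_prod V id (F (k, 0))) = 0"
    using fun_cong[OF eq, of "(k, 0)"] k by (simp add: zero_prod_def)
  then have "map_prod V id (F (k, 0)) = 0"
    using invertible_op_inv_simps(1)[OF E] bounded_clinear_map_0[of "inv E"] E
    by (metis invertible_op_def)
  then show "F (k, 0) = (fst (F (k, 0)), 0)" "V (fst (F (k, 0))) = 0"
    by (cases "F (k, 0)"; simp add: zero_prod_def)+
qed

text \<open>Since \<open>F\<close> is onto, \<open>E\<close> carries the range of
  \<open>V \<oplus> I\<close> into that of \<open>U \<oplus> I\<close>.\<close>

lemma range_transfer:
  assumes eq: "map_prod U id = E \<circ> map_prod V id \<circ> F" and F: "invertible_op F"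
  shows "fst (E (V y, z)) \<in> range U"
proof -
  have "E (V y, z) = map_prod U id (inv F (y, z))"
    using fun_cong[OF eq, of "inv F (y, z)"] invertible_op_inv_simps(2)[OF F] by simp
  then show ?thesis
    by (cases "inv F (y, z)") auto
qed

lemma equivalence_symmetric:
  assumes eq: "M = E \<circ> N \<circ> F" and E: "invertible_op E" and F: "invertible_op F"
  shows "N = inv E \<circ> M \<circ> inv F"
  by (simp add: eq fun_eq_iff invertible_op_inv_simps[OF E] invertible_op_inv_simps[OF F])

text \<open>The vector \<open>a\<close> lies in the kernel of \<open>V\<close>, so the correction
  \<open>H (V a)\<close> vanishes and \<open>inv F\<close> undoes \<open>F\<close>.\<close>

lemma kernel_round_trip:
  assumes eq: "map_prod U id = E \<circ> map_prod V id \<circ> F"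
    and E: "invertible_op E" and F: "invertible_op F"
    and H: "bounded_clinear H" and k: "U k = 0"
  defines "a \<equiv> fst (F (k, 0))"
  shows "fst (inv F (a - H (V a), 0)) = k"
  using kernel_transfer[OF eq E k] invertible_op_inv_simps(1)[OF F, of "(k, 0)"]
  by (simp add: a_def bounded_clinear_map_0[OF H])

text \<open>With \<open>inv E (x, 0) = (q, r)\<close>, the vector \<open>E (q - V (H q), 0)\<close>
  differs from \<open>(x, 0)\<close> by \<open>E (V (H q), r)\<close>, whose first component lies in
  the range of \<open>U\<close> and is killed by \<open>P\<close>.\<close>

lemma cokernel_round_trip:
  assumes eq: "map_prod U id = E \<circ> map_prod V id \<circ> F"
    and E: "invertible_op E" and F: "invertible_op F"
    and U: "bounded_clinear U" and G: "bounded_clinear G" and UGU: "\<And>x. U (G (U x)) = U x"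
  defines "P \<equiv> \<lambda>x. x - U (G x)" and "q \<equiv> \<lambda>x. fst (inv E (x, 0))"
  shows "P (fst (E (q x - V (H (q x)), 0))) = P x"
proof -
  have bE: "bounded_clinear E"
    using E by (simp add: invertible_op_def)
  obtain r where r: "inv E (x, 0) = (q x, r)"
    by (metis q_def prod.collapse)
  have P: "bounded_clinear P"
    unfolding P_def
    by (intro bounded_clinear_intros bounded_clinear_compose[OF U] bounded_clinear_compose[OF G])
  have "P (fst (E (V (H (q x)), r))) = 0"
    using range_transfer[OF eq F, of "H (q x)" r] UGU by (auto simp: P_def)
  moreover have "E (q x - V (H (q x)), 0) = (x, 0) - E (V (H (q x)), r)"
  proof -
    have "E (q x - V (H (q x)), 0) = E ((q x, r) - (V (H (q x)), r))"
      by simp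
    also have "\<dots> = (x, 0) - E (V (H (q x)), r)"
      using r invertible_op_inv_simps(2)[OF E] by (metis bounded_clinear_map_diff[OF bE])
    finally show ?thesis .
  qed
  ultimately show ?thesis
    by (simp add: bounded_clinear_map_diff[OF P])
qed

lemma equivalent_after_extension_imp_equivalent:
  fixes U :: "'x::complex_banach \<Rightarrow> 'x" and V :: "'y::complex_banach \<Rightarrow> 'y"
  assumes eae: "equivalent_after_extension TYPE('x0::complex_banach) TYPE('y0::complex_banach) U V"
    and gU: "generalized_invertible U" and gV: "generalized_invertible V"
  obtains E F :: "'x \<times> 'y \<Rightarrow> 'x \<times> 'y" where "invertible_op E" "invertible_op F"
    "map_prod U id = E \<circ> map_prod id V \<circ> F"
proof -
  obtain E :: "'y \<times> 'y0 \<Rightarrow> 'x \<times> 'x0" and F where E: "invertible_op E" and F: "invertible_op F"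
      and eq: "map_prod U id = E \<circ> map_prod V id \<circ> F"
    using eae unfolding equivalent_after_extension_def by blast
  have U: "bounded_clinear U" and V: "bounded_clinear V"
    using gU gV by (auto simp: generalized_invertible_def)
  obtain G where G: "bounded_clinear G" and UGU: "\<And>x. U (G (U x)) = U x"
      and GUG: "\<And>x. G (U (G x)) = G x"
    using generalized_inverse_exists[OF gU] by blast
  obtain H where H: "bounded_clinear H" and VHV: "\<And>y. V (H (V y)) = V y"
      and HVH: "\<And>y. H (V (H y)) = H y"
    using generalized_inverse_exists[OF gV] by blast
  note E' = invertible_op_inv[OF E] and F' = invertible_op_inv[OF F]
  have invinv: "inv (inv E) = E" "inv (inv F) = F"
    using E F by (auto simp: invertible_op_def inv_inv_eq)
  note eq' = equivalence_symmetric[OF eq E F]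
  \<comment> \<open>The inner differences project onto a kernel or onto a complement of a range. The
    maps \<open>c\<close> and \<open>d\<close> project once more, since \<open>inv E\<close> and
    \<open>E\<close> need not carry one complement into the other.\<close>
  define a where "a x = fst (F (x - G (U x), 0))" for x
  define b where "b y = fst (inv F (y - H (V y), 0))" for y
  define c where "c x = (let q = fst (inv E (x - U (G x), 0)) in q - V (H q))" for x
  define d where "d y = (let p = fst (E (y - V (H y), 0)) in p - U (G p))" for y
  have bEF: "bounded_clinear E" "bounded_clinear F" "bounded_clinear (inv E)" "bounded_clinear (inv F)"
    using E F by (auto simp: invertible_op_def)
  note comp = bounded_clinear_compose[OF U] bounded_clinear_compose[OF V]
    bounded_clinear_compose[OF G] bounded_clinear_compose[OF H]
    bEF[THEN bounded_clinear_compose]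
  have bnd: "bounded_clinear a" "bounded_clinear b" "bounded_clinear c" "bounded_clinear d"
    unfolding a_def b_def c_def d_def Let_def by (intro bounded_clinear_intros comp)+
  note bl = U V G H bnd
  note add = bl[THEN bounded_clinear_map_add] and diff = bl[THEN bounded_clinear_map_diff]
    and zero = bl[THEN bounded_clinear_map_0]
  have kU: "U (x - G (U x)) = 0" and kV: "V (y - H (V y)) = 0" for x y
    by (simp_all add: diff UGU VHV)
  have aG: "a (G x) = 0" and bH: "b (H y) = 0" and cU: "c (U x) = 0" and dV: "d (V y) = 0" for x y
    using bEF[THEN bounded_clinear_map_0]
    by (simp_all add: a_def b_def c_def d_def GUG HVH UGU VHV zero zero_prod_def)
  have Va: "V (a x) = 0" and Ub: "U (b y) = 0" for x y
    using kernel_transfer(2)[OF eq E kU] kernel_transfer(2)[OF eq' E' kV]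
    by (simp_all add: a_def b_def)
  have Hc: "H (c x) = 0" and Gd: "G (d y) = 0" for x y
    by (simp_all add: c_def d_def Let_def diff GUG HVH)
  have ba: "b (a x) = x - G (U x)" for x
    using kernel_round_trip[OF eq E F H kU] by (simp add: a_def b_def)
  have ab: "a (b y) = y - H (V y)" for y
    using kernel_round_trip[OF eq' E' F' G kV] by (simp add: a_def b_def invinv)
  have dc: "d (c x) = x - U (G x)" for x
    using cokernel_round_trip[OF eq E F U G UGU, where H = H and x = "x - U (G x)"]
    by (simp add: c_def d_def Let_def diff VHV HVH UGU GUG zero)
  have cd: "c (d y) = y - V (H y)" for y
    using cokernel_round_trip[OF eq' E' F' V H VHV, where H = G and x = "y - V (H y)"]
    by (simp add: c_def d_def Let_def diff VHV HVH UGU GUG zero invinv)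
  txt \<open>
    Here \<open>a\<close>, \<open>b\<close> are the mutually inverse isomorphisms between the kernels and \<open>c\<close>, \<open>d\<close>
    those between the cokernels, extended by zero. The operator \<open>F\<close> below swaps the two kernels.
  \<close>
  let ?F = "\<lambda>p. (G (U (fst p)) + b (snd p), a (fst p) + H (V (snd p)))"
  \<comment> \<open>Here \<open>U\<close> maps \<open>range G\<close> onto \<open>range U\<close>,
    \<open>d\<close> fills the complement of \<open>range U\<close>, \<open>a\<close> maps onto the
    kernel of \<open>V\<close>, and \<open>H\<close> fills \<open>range H\<close>;
    \<open>?E'\<close> inverts the four pieces separately.\<close>
  let ?E = "\<lambda>p. (U (fst p) + d (snd p), a (fst p) + H (snd p))"
  let ?E' = "\<lambda>p. (G (fst p) + b (snd p), c (fst p) + V (snd p))"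
  note comp' = comp bnd[THEN bounded_clinear_compose]
  note rules = add zero UGU GUG VHV HVH aG bH cU dV Va Ub Hc Gd ba ab dc cd
  have bE: "bounded_clinear ?E" "bounded_clinear ?E'" and bF: "bounded_clinear ?F"
    by (intro bounded_clinear_intros comp')+
  show thesis
  proof
    show "invertible_op ?E"
      by (rule invertible_opI[OF bE]) (simp_all add: rules)
    show "invertible_op ?F"
      \<comment> \<open>Swapping the kernels twice gives the identity, so \<open>?F\<close> is its
        own inverse.\<close>
      by (rule invertible_opI[OF bF bF]) (simp_all add: rules)
    show "map_prod U id = ?E \<circ> map_prod id V \<circ> ?F"
      by (simp add: fun_eq_iff rules)
  qed
qed

theorem proposition4p2:
  fixes U :: "'x::complex_banach \<Rightarrow> 'x" and V :: "'y::complex_banach \<Rightarrow> 'y"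
  assumes "bounded_clinear U" and "bounded_clinear V"
    and "equivalent_after_extension TYPE('x0::complex_banach) TYPE('y0::complex_banach) U V"
    and "(atkinson U \<and> atkinson V \<and>
          stable_under_fd_quotients TYPE('x) \<and> stable_under_fd_quotients TYPE('y)) \<or>
         (generalized_invertible U \<and> generalized_invertible V \<and>
          primary TYPE('x) \<and> primary TYPE('y))"
  shows "(\<exists>W :: 'x \<times> 'y \<Rightarrow> 'x \<times> 'y.
            bounded_clinear W \<and> schur_coupled U W \<and> schur_coupled V W) \<and>
         (schur_coupled U (map_prod U (id :: 'y \<Rightarrow> 'y)) \<and>
          schur_coupled V (map_prod U (id :: 'y \<Rightarrow> 'y))) \<and>
         (schur_coupled U (map_prod (id :: 'x \<Rightarrow> 'x) V) \<and>
          schur_coupled V (map_prod (id :: 'x \<Rightarrow> 'x) V))"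
proof -
  have U: "bounded_clinear U" and V: "bounded_clinear V"
    by (fact assms)+
  have "generalized_invertible U" "generalized_invertible V"
    using assms(4) by (auto simp: atkinson_def)
  then obtain E F :: "'x \<times> 'y \<Rightarrow> 'x \<times> 'y" where E: "invertible_op E" and F: "invertible_op F"
      and eq: "map_prod U id = E \<circ> map_prod id V \<circ> F"
    using equivalent_after_extension_imp_equivalent[OF assms(3)] by blast
  have UU: "schur_coupled U (map_prod U (id :: 'y \<Rightarrow> 'y))"
    by (rule schur_coupled_map_prod_id_right[OF U])
  have VV: "schur_coupled V (map_prod (id :: 'x \<Rightarrow> 'x) V)"
    by (rule schur_coupled_map_prod_id_left[OF V])
  have VU: "schur_coupled V (map_prod U (id :: 'y \<Rightarrow> 'y))"
    unfolding eq by (rule schur_coupled_equivalent[OF VV E F])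
  have UV: "schur_coupled U (map_prod (id :: 'x \<Rightarrow> 'x) V)"
    \<comment> \<open>The equivalence is now read backwards, from \<open>U \<oplus> I\<close> to
      \<open>I \<oplus> V\<close>.\<close>
    unfolding equivalence_symmetric[OF eq E F]
    by (rule schur_coupled_equivalent[OF UU invertible_op_inv[OF E] invertible_op_inv[OF F]])
  have "bounded_clinear (map_prod U (id :: 'y \<Rightarrow> 'y))"
    using U bounded_clinear_ident by (auto simp: id_def intro: bounded_clinear_map_prod)
  then show ?thesis
    using UU VV UV VU by blast
qed

end
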